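(* Let $d\geq 1$ and $N\geq d$ be integers. A generic frame in $\mathcal{F}^{\mathbb{C}}_{N,d}$ is full spark, and a generic frame in $\mathcal{F}^{\mathbb{R}}_{N,d}$ is full spark. That is, for $\mathbb{F}=\mathbb{R}$ and for $\mathbb{F}=\mathbb{C}$, the set of full spark frames in $\mathcal{F}^{\mathbb{F}}_{N,d}$ contains a subset that is open and dense in $\mathcal{F}^{\mathbb{F}}_{N,d}$.
   Context: For $\mathbb{F}=\mathbb{R}$ or $\mathbb{C}$, $\mathcal{F}_{N,d}^{\mathbb{F}}$ denotes the set of finite unit norm tight frames (FUNTFs): $d\times N$ matrices $F=(f_1\ \cdots\ f_N)$ over $\mathbb{F}$ with $\|f_n\|=1$ for all $n$ and $FF^*=\frac{N}{d}I_d$, with the topology induced by the standard (Euclidean) topology on $d\times N$ matrices over $\mathbb{F}$. A frame $F=\{f_n\}_{n=1}^N$ for $\mathbb{F}^d$ is full spark if every subcollection of $d$ of its elements is linearly independent. A subset $W$ of a subset $V$ of Euclidean space is generic in $V$ if $W$ contains a set that is open and dense in $V$ in the topology induced on $V$ by the standard topology. *)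

theory Defs
  imports "HOL-Analysis.Analysis"
begin

text \<open>
  A frame of \<open>N = CARD('n)\<close> vectors in \<open>d\<close>-dimensional space, \<open>d = CARD('d)\<close>, is its
  \<open>d \<times> N\<close> synthesis matrix of type \<open>'a^'n^'d\<close>; the \<open>j\<close>-th frame vector is \<open>column j F\<close>.
\<close>

definition conj_transpose :: "complex^'n^'d \<Rightarrow> complex^'d^'n" where
  "conj_transpose F = (\<chi> j i. cnj (F $ i $ j))"

definition real_FUNTF :: "(real^'n::finite^'d::finite) set" where
  "real_FUNTF = {F. (\<forall>j. norm (column j F) = 1) \<and>
     F ** transpose F = mat (of_nat CARD('n) / of_nat CARD('d))}"

definition complex_FUNTF :: "(complex^'n::finite^'d::finite) set" where
  "complex_FUNTF = {F. (\<forall>j. norm (column j F) = 1) \<and>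
     F ** conj_transpose F = mat (of_nat CARD('n) / of_nat CARD('d))}"

text \<open>
  Subcollections are indexed families, so a repeated vector counts as a dependence; hence
  the injectivity requirement.  \<open>vec.independent\<close> is independence over the entry field \<open>'a\<close>
  (for \<open>complex\<close> it is complex-linear, unlike the plain constant \<open>independent\<close>).
\<close>

definition full_spark :: "'a::field^'n::finite^'d::finite \<Rightarrow> bool" where
  "full_spark F \<longleftrightarrow> (\<forall>S. card S = CARD('d) \<longrightarrow>
     inj_on (\<lambda>j. column j F) S \<and> vec.independent ((\<lambda>j. column j F) ` S))"

definition generic_in :: "'a::euclidean_space set \<Rightarrow> 'a set \<Rightarrow> bool" where
  "generic_in W V \<longleftrightarrow> W \<subseteq> V \<and>
     (\<exists>U\<subseteq>W. openin (top_of_set V) U \<and> top_of_set V closure_of U = V)"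

end

theory Submission
  imports Defs
begin

text \<open>
  Linear independence of fixed columns is an open condition, so everything rests on density:
  near any unit norm tight frame \<open>F\<close> there has to be another one in which a given set \<open>T\<close> of at
  most \<open>d\<close> columns is independent.  Finitely many such dense open conditions then intersect in a
  dense open set.

  The columns of \<open>T\<close> are made independent one at a time, so the columns of \<open>F\<close> in \<open>T\<close> may be
  assumed to satisfy exactly one linear relation \<open>\<Sum> c\<^sub>s f\<^sub>s = 0\<close>, up to scaling.  They then fail to
  span the space, whereas a tight frame spans it, so some frame vector \<open>f\<^sub>j\<close> lies outside their
  span.  Right multiplication by a unitary matrix preserves \<open>F F\<^sup>*\<close>; it is used to move a little of
  \<open>f\<^sub>j\<close> into the vectors of \<open>T\<close>, and the whole difficulty is to keep all norms equal to 1.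

  Over \<open>\<complex>\<close> a rotation in the plane of \<open>f\<^sub>k\<close> and a suitable multiple \<open>w f\<^sub>j\<close>, \<open>|w| = 1\<close>, keeps both norms,
  since \<open>w\<close> can be chosen to make \<open>\<langle>f\<^sub>k, w f\<^sub>j\<rangle>\<close> purely imaginary.  With \<open>c\<^sub>k \<noteq> 0\<close> the new \<open>f\<^sub>k\<close> leaves the span of
  the others (\<open>perturb_complex\<close>).

  Over \<open>\<real>\<close> this works if \<open>f\<^sub>j\<close> is orthogonal to some \<open>f\<^sub>k\<close> with \<open>c\<^sub>k \<noteq> 0\<close>.  Otherwise three vectors are moved.
  If \<open>f\<^sub>i\<close>, \<open>f\<^sub>j\<close>, \<open>f\<^sub>k\<close> are pairwise non-orthogonal, there is a curve of orthogonal matrices that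
  keeps their three norms (\<open>triple_rotation_angles\<close>), and modulo the span of \<open>T\<close> it adds to \<open>f\<^sub>i\<close> and \<open>f\<^sub>k\<close>
  multiples of \<open>f\<^sub>j\<close> that are to first order in the ratio \<open>\<langle>f\<^sub>j, f\<^sub>k\<rangle> : - \<langle>f\<^sub>j, f\<^sub>i\<rangle>\<close>.  The relation \<open>c\<close> is broken by
  this as soon as \<open>c\<^sub>i \<langle>f\<^sub>j, f\<^sub>k\<rangle> \<noteq> c\<^sub>k \<langle>f\<^sub>j, f\<^sub>i\<rangle>\<close> (\<open>indep_cols_first_order\<close>).  That such a pair of non-orthogonal vectors
  \<open>f\<^sub>i\<close>, \<open>f\<^sub>k\<close> exists is the heart of the real case (\<open>nonproportional_pair\<close>).
\<close>

section \<open>Independence of selected columns\<close>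

text \<open>
  A family of columns indexed by \<open>T\<close> is handled through coefficient vectors indexed by all columns but
  vanishing off \<open>T\<close>: these form a closed subspace of one fixed Euclidean space, which is what the
  compactness arguments need.
\<close>

definition coeffs_on :: "'n set \<Rightarrow> ('a::zero^'n::finite) set" where
  "coeffs_on T = {x. \<forall>s. s \<notin> T \<longrightarrow> x $ s = 0}"

definition indep_cols :: "'a::field^'n::finite^'d::finite \<Rightarrow> 'n set \<Rightarrow> bool" where
  "indep_cols F T \<longleftrightarrow> (\<forall>x \<in> coeffs_on T. F *v x = 0 \<longrightarrow> x = 0)"

definition sole_dependence ::
    "'a::field^'n::finite^'d::finite \<Rightarrow> 'n set \<Rightarrow> 'a^'n \<Rightarrow> bool" where
  "sole_dependence F T c \<longleftrightarrow> c \<in> coeffs_on T \<and> c \<noteq> 0 \<and> F *v c = 0 \<and>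
     (\<forall>x \<in> coeffs_on T. F *v x = 0 \<longrightarrow> (\<exists>m. x = m *s c))"

lemma mult_coeffs_on:
  fixes F :: "'a::field^'n::finite^'d::finite"
  assumes "x \<in> coeffs_on T"
  shows "F *v x = (\<Sum>s\<in>T. x $ s *s column s F)"
  unfolding matrix_mult_sum
  using assms by (intro sum.mono_neutral_right) (auto simp: coeffs_on_def)

lemma mult_axis:
  fixes F :: "'a::field^'n::finite^'d::finite"
  shows "F *v axis s 1 = column s F"
  by (simp add: vec_eq_iff matrix_vector_mult_def axis_def column_def if_distrib cong: if_cong)

lemma axis_coeffs_on: "s \<in> T \<Longrightarrow> axis s a \<in> coeffs_on T"
  by (auto simp: coeffs_on_def axis_def)

lemma not_mem_if_column_outside:
  fixes F :: "'a::field^'n::finite^'d::finite"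
  assumes "\<And>x. x \<in> coeffs_on T \<Longrightarrow> F *v x \<noteq> column j F"
  shows "j \<notin> T"
  using assms[OF axis_coeffs_on[of j T 1]] by (auto simp: mult_axis)

lemma indep_cols_iff:
  fixes F :: "'a::field^'n::finite^'d::finite"
  shows "indep_cols F T \<longleftrightarrow>
    inj_on (\<lambda>s. column s F) T \<and> vec.independent ((\<lambda>s. column s F) ` T)"
proof
  assume ind: "indep_cols F T"
  have inj: "inj_on (\<lambda>s. column s F) T"
  proof (rule inj_onI, rule ccontr)
    fix s t assume st: "s \<in> T" "t \<in> T" "column s F = column t F" "s \<noteq> t"
    let ?x = "axis s 1 - axis t 1 :: 'a^'n"
    have "?x \<in> coeffs_on T" using st by (auto simp: coeffs_on_def axis_def)
    moreover have "F *v ?x = 0"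
      using st by (simp add: matrix_vector_mult_diff_distrib mult_axis)
    ultimately have "?x = 0" using ind by (auto simp: indep_cols_def)
    hence "?x $ s = 0" by simp
    thus False using st by (simp add: axis_def)
  qed
  have "vec.independent ((\<lambda>s. column s F) ` T)"
  proof (rule ccontr)
    assume "\<not> ?thesis"
    then obtain u v where u: "v \<in> (\<lambda>s. column s F) ` T" "u v \<noteq> 0"
      "(\<Sum>v\<in>(\<lambda>s. column s F) ` T. u v *s v) = 0"
      using vec.dependent_finite[of "(\<lambda>s. column s F) ` T"] by auto
    define x :: "'a^'n" where "x = (\<chi> s. if s \<in> T then u (column s F) else 0)"
    have x: "x \<in> coeffs_on T" by (simp add: coeffs_on_def x_def)
    have "F *v x = (\<Sum>s\<in>T. u (column s F) *s column s F)"
      unfolding mult_coeffs_on[OF x] by (simp add: x_def)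
    also have "\<dots> = 0" using u(3) by (simp add: sum.reindex[OF inj])
    finally have "x = 0" using x ind by (auto simp: indep_cols_def)
    moreover from u(1) obtain s where s: "s \<in> T" "v = column s F" by auto
    ultimately have "x $ s = 0" by simp
    thus False using u(2) s by (simp add: x_def)
  qed
  with inj show "inj_on (\<lambda>s. column s F) T \<and> vec.independent ((\<lambda>s. column s F) ` T)" ..
next
  assume R: "inj_on (\<lambda>s. column s F) T \<and> vec.independent ((\<lambda>s. column s F) ` T)"
  show "indep_cols F T" unfolding indep_cols_def
  proof (intro ballI impI)
    fix x :: "'a^'n" assume x: "x \<in> coeffs_on T" "F *v x = 0"
    define u where "u = (\<lambda>v. x $ the_inv_into T (\<lambda>s. column s F) v)"
    have u: "u (column s F) = x $ s" if "s \<in> T" for s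
      using R that the_inv_into_f_f[of "\<lambda>s. column s F" T s] by (simp add: u_def)
    have "(\<Sum>v\<in>(\<lambda>s. column s F) ` T. u v *s v) = 0"
      using x mult_coeffs_on[OF x(1), of F] R by (simp add: sum.reindex u)
    hence "\<forall>v\<in>(\<lambda>s. column s F) ` T. u v = 0"
      using R vec.dependent_finite[of "(\<lambda>s. column s F) ` T"] by auto
    hence "x $ s = 0" for s using u x(1) by (cases "s \<in> T") (auto simp: coeffs_on_def)
    thus "x = 0" by (simp add: vec_eq_iff)
  qed
qed

lemma full_spark_iff:
  "full_spark F \<longleftrightarrow> (\<forall>S. card S = CARD('d) \<longrightarrow> indep_cols F S)"
  for F :: "'a::field^'n::finite^'d::finite"
  by (simp add: full_spark_def indep_cols_iff)

text \<open>
  Otherwise the columns in \<open>T\<close> span everything; being at most \<open>d\<close> in number, they would form a basis.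
\<close>

lemma column_outside_dependent:
  fixes F :: "'a::field^'n::finite^'d::finite"
  assumes surj: "surj ((*v) F)" and dep: "\<not> indep_cols F T" and card: "card T \<le> CARD('d)"
  obtains j where "\<And>x. x \<in> coeffs_on T \<Longrightarrow> F *v x \<noteq> column j F"
proof (rule ccontr)
  assume "\<not> thesis"
  with that have all: "\<exists>x\<in>coeffs_on T. F *v x = column j F" for j by blast
  let ?C = "(\<lambda>s. column s F) ` T"
  have inC: "column j F \<in> vec.span ?C" for j
  proof -
    obtain x where x: "x \<in> coeffs_on T" "F *v x = column j F" using all by blast
    have "(\<Sum>s\<in>T. x $ s *s column s F) \<in> vec.span ?C"
      by (intro vec.span_sum vec.span_scale vec.span_base) auto
    thus ?thesis using x mult_coeffs_on[OF x(1), of F] by simp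
  qed
  have "y \<in> vec.span ?C" for y
  proof -
    obtain x where "y = F *v x" using surj by (meson surjD)
    thus ?thesis by (auto simp: matrix_mult_sum intro!: vec.span_sum vec.span_scale inC)
  qed
  hence span: "vec.span ?C = UNIV" by auto
  have "CARD('d) = vec.dim (UNIV :: ('a^'d) set)" by (simp add: vec.dim_UNIV vec.dimension_def card_cart_basis)
  also have "\<dots> \<le> card ?C" by (rule vec.span_card_ge_dim) (auto simp: span)
  finally have ge: "CARD('d) \<le> card ?C" .
  moreover have "card ?C \<le> card T" by (rule card_image_le) auto
  ultimately have eq: "card ?C = card T" "card ?C = CARD('d)" using card by auto
  from eq(1) have "inj_on (\<lambda>s. column s F) T" by (intro eq_card_imp_inj_on) auto
  moreover have "vec.independent ?C"
    by (rule vec.card_le_dim_spanning[of _ UNIV])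
      (auto simp: span eq(2) vec.dim_UNIV vec.dimension_def card_cart_basis)
  ultimately show False using dep by (simp add: indep_cols_iff)
qed

text \<open>
  Two relations can be combined so that column \<open>i\<close> cancels, and what remains is a relation on \<open>B\<close>.
\<close>

lemma sole_dependence_insert:
  fixes F :: "'a::field^'n::finite^'d::finite"
  assumes B: "indep_cols F B" and dep: "\<not> indep_cols F (insert i B)"
  obtains c where "sole_dependence F (insert i B) c"
proof -
  obtain c where c: "c \<in> coeffs_on (insert i B)" "F *v c = 0" "c \<noteq> 0"
    using dep by (auto simp: indep_cols_def)
  have ci: "c $ i \<noteq> 0"
  proof
    assume "c $ i = 0"
    hence "c \<in> coeffs_on B" using c(1) by (auto simp: coeffs_on_def)
    thus False using B c by (auto simp: indep_cols_def)
  qed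
  have "\<exists>m. x = m *s c" if x: "x \<in> coeffs_on (insert i B)" "F *v x = 0" for x
  proof -
    let ?m = "x $ i / c $ i"
    have "x $ s = ?m * c $ s" if "s \<notin> B" for s
      using x(1) c(1) ci that by (cases "s = i") (auto simp: coeffs_on_def)
    hence "x - ?m *s c \<in> coeffs_on B" by (simp add: coeffs_on_def)
    moreover have "F *v (x - ?m *s c) = 0"
      by (simp add: matrix_vector_mult_diff_distrib vector_scalar_commute x c)
    ultimately have "x - ?m *s c = 0" using B by (auto simp: indep_cols_def)
    thus ?thesis by auto
  qed
  thus thesis using that c by (auto simp: sole_dependence_def)
qed

section \<open>Openness, and reduction of genericity to a perturbation step\<close>

text \<open>
  Relations can be normalised to lie on the unit sphere, so by compactness a subsequence of them
  converges.  The relations themselves are returned, and not just the limit, because the first-order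
  argument below evaluates a functional on them.
\<close>

lemma dependence_limit:
  fixes G :: "nat \<Rightarrow> 'a::{euclidean_space,real_normed_field}^'n::finite^'d::finite"
  assumes lim: "G \<longlonglongrightarrow> F" and dep: "\<And>n. \<not> indep_cols (G n) T"
  obtains r x x0 where "strict_mono (r :: nat \<Rightarrow> nat)" "\<And>n. x n \<in> coeffs_on T"
    "\<And>n. G (r n) *v x n = 0" "x \<longlonglongrightarrow> x0" "x0 \<in> coeffs_on T" "x0 \<noteq> 0" "F *v x0 = 0"
proof -
  have "\<exists>y. y \<in> coeffs_on T \<and> G n *v y = 0 \<and> norm y = 1" for n
  proof -
    obtain y where y: "y \<in> coeffs_on T" "G n *v y = 0" "y \<noteq> 0"
      using dep[of n] by (auto simp: indep_cols_def)
    have eq: "y /\<^sub>R norm y = of_real (inverse (norm y)) *s y"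
      by (simp add: vec_eq_iff scaleR_conv_of_real[where 'a='a])
    have "y /\<^sub>R norm y \<in> coeffs_on T" using y by (simp add: coeffs_on_def)
    moreover have "G n *v (y /\<^sub>R norm y) = 0"
      unfolding eq by (simp only: vector_scalar_commute y) simp
    moreover have "norm (y /\<^sub>R norm y) = 1" using y by simp
    ultimately show ?thesis by blast
  qed
  then obtain y where y: "\<And>n. y n \<in> coeffs_on T" "\<And>n. G n *v y n = 0" "\<And>n. norm (y n) = 1"
    by metis
  have "compact (sphere (0::'a^'n) 1)" by simp
  moreover have "\<forall>n. y n \<in> sphere 0 1" using y by simp
  ultimately obtain x0 r where x0: "x0 \<in> sphere 0 1" "strict_mono r" "(y \<circ> r) \<longlonglongrightarrow> x0"
    unfolding compact_def by meson
  have yx: "(\<lambda>n. y (r n) $ s) \<longlonglongrightarrow> x0 $ s" for s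
    using tendsto_vec_nth[OF x0(3)] by (simp add: o_def)
  have Gx: "(\<lambda>n. G (r n) $ a $ s) \<longlonglongrightarrow> F $ a $ s" for a s
    using tendsto_vec_nth[OF tendsto_vec_nth[OF LIMSEQ_subseq_LIMSEQ[OF lim x0(2)]]] by (simp add: o_def)
  have x0T: "x0 \<in> coeffs_on T" unfolding coeffs_on_def
  proof (intro CollectI allI impI)
    fix s assume "s \<notin> T"
    hence "(\<lambda>n. y (r n) $ s) = (\<lambda>n. 0)" using y(1) by (auto simp: coeffs_on_def)
    thus "x0 $ s = 0" using yx[of s] by (simp add: LIMSEQ_const_iff)
  qed
  have "(F *v x0) $ a = 0" for a
  proof -
    have "(\<lambda>n. (G (r n) *v y (r n)) $ a) \<longlonglongrightarrow> (F *v x0) $ a"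
      unfolding matrix_vector_mult_def by (simp, intro tendsto_intros Gx yx)
    thus ?thesis by (simp add: y(2) LIMSEQ_const_iff)
  qed
  hence "F *v x0 = 0" by (simp add: vec_eq_iff)
  moreover have "x0 \<noteq> 0" using x0(1) by auto
  moreover have "(y \<circ> r) n \<in> coeffs_on T" "G (r n) *v (y \<circ> r) n = 0" for n
    using y by simp_all
  ultimately show thesis using that[OF x0(2) _ _ x0(3) x0T] by blast
qed

lemma open_indep_cols:
  "open {F :: 'a::{euclidean_space,real_normed_field}^'n::finite^'d::finite. indep_cols F T}"
proof -
  have "closed {F :: 'a^'n^'d. \<not> indep_cols F T}"
    unfolding closed_sequential_limits
  proof (intro allI impI)
    fix G and F :: "'a^'n^'d"
    assume "(\<forall>n. G n \<in> {F. \<not> indep_cols F T}) \<and> G \<longlonglongrightarrow> F"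
    hence lim: "G \<longlonglongrightarrow> F" and dep: "\<And>n. \<not> indep_cols (G n) T" by auto
    obtain x0 where "x0 \<in> coeffs_on T" "x0 \<noteq> 0" "F *v x0 = 0"
      by (rule dependence_limit[OF lim dep])
    thus "F \<in> {F. \<not> indep_cols F T}" by (auto simp: indep_cols_def)
  qed
  thus ?thesis unfolding open_closed by (simp only: Compl_eq mem_Collect_eq)
qed

text \<open>
  It is enough to repair a frame in which \<open>T\<close> carries a single relation, with a frame vector \<open>j\<close> outside
  the span: induction on \<open>T\<close> produces this situation whenever adding one index to an independent set
  destroys independence.  The sets \<open>S\<close> of size \<open>d\<close> are then treated one after the other, each
  perturbation being small enough to keep the independence already achieved.
\<close>

lemma generic_full_spark_if_perturbable:
  fixes X :: "('a::{euclidean_space,real_normed_field}^'n::finite^'d::finite) set"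
  assumes surj: "\<And>F. F \<in> X \<Longrightarrow> surj ((*v) F)"
    and perturb: "\<And>F T c j e. \<lbrakk>F \<in> X; sole_dependence F T c;
        \<And>x. x \<in> coeffs_on T \<Longrightarrow> F *v x \<noteq> column j F; e > 0\<rbrakk>
        \<Longrightarrow> \<exists>F'\<in>X. dist F' F < e \<and> indep_cols F' T"
  shows "generic_in {F \<in> X. full_spark F} X"
proof -
  have one: "\<forall>F\<in>X. \<forall>e>0. \<exists>F'\<in>X. dist F' F < e \<and> indep_cols F' T"
    if "card T \<le> CARD('d)" for T :: "'n set"
    using finite[of T] that
  proof (induction T rule: finite_induct)
    case empty
    have "indep_cols F {}" for F :: "'a^'n^'d"
      by (auto simp: indep_cols_def coeffs_on_def vec_eq_iff)
    thus ?case by (metis dist_self)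
  next
    case (insert i B)
    show ?case
    proof (intro ballI allI impI)
      fix F e assume F: "F \<in> X" "(e::real) > 0"
      have "card B \<le> CARD('d)" using insert by simp
      then obtain F1 where F1: "F1 \<in> X" "dist F1 F < e/2" "indep_cols F1 B"
        using insert.IH F by (metis half_gt_zero)
      show "\<exists>F'\<in>X. dist F' F < e \<and> indep_cols F' (insert i B)"
      proof (cases "indep_cols F1 (insert i B)")
        case True
        thus ?thesis using F1 F by (intro bexI[of _ F1]) auto
      next
        case False
        obtain c where c: "sole_dependence F1 (insert i B) c"
          using sole_dependence_insert[OF F1(3) False] .
        obtain j where j: "\<And>x. x \<in> coeffs_on (insert i B) \<Longrightarrow> F1 *v x \<noteq> column j F1"
          using column_outside_dependent[OF surj[OF F1(1)] False insert.prems] by blast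
        obtain F2 where F2: "F2 \<in> X" "dist F2 F1 < e/2" "indep_cols F2 (insert i B)"
          using perturb[OF F1(1) c j, of "e/2"] F by auto
        have "dist F2 F < e"
          using F2(2) F1(2) dist_triangle_half_r[of F1 F2 e F] by (simp add: dist_commute)
        with F2 show ?thesis by blast
      qed
    qed
  qed
  have all: "\<forall>F\<in>X. \<forall>e>0. \<exists>F'\<in>X. dist F' F < e \<and> (\<forall>S\<in>\<S>. indep_cols F' S)"
    if "\<S> \<subseteq> {S. card S = CARD('d)}" for \<S> :: "'n set set"
    using finite[of \<S>] that
  proof (induction \<S> rule: finite_induct)
    case empty
    thus ?case by (metis dist_self empty_iff)
  next
    case (insert S \<S>)
    show ?case
    proof (intro ballI allI impI)
      fix F e assume F: "F \<in> X" "(e::real) > 0"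
      obtain F1 where F1: "F1 \<in> X" "dist F1 F < e/2" "\<forall>S\<in>\<S>. indep_cols F1 S"
        using insert F by (metis half_gt_zero insert_subset)
      have "open (\<Inter>S\<in>\<S>. {F :: 'a^'n^'d. indep_cols F S})"
        by (intro open_INT insert open_indep_cols ballI)
      moreover have "F1 \<in> (\<Inter>S\<in>\<S>. {F. indep_cols F S})" using F1 by auto
      ultimately have "\<exists>r>0. \<forall>G. dist G F1 < r \<longrightarrow> G \<in> (\<Inter>S\<in>\<S>. {F. indep_cols F S})"
        unfolding open_dist by (rule bspec)
      then obtain r where r: "r > 0" "\<And>G. dist G F1 < r \<Longrightarrow> \<forall>S\<in>\<S>. indep_cols G S"
        by auto
      obtain F2 where F2: "F2 \<in> X" "dist F2 F1 < min r (e/2)" "indep_cols F2 S"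
      proof -
        have "card S \<le> CARD('d)" using insert.prems by simp
        moreover have "min r (e/2) > 0" using r(1) F(2) by simp
        ultimately show thesis using one[of S] F1(1) that by blast
      qed
      have "\<exists>F'\<in>X. dist F' F < e \<and> (\<forall>S\<in>insert S \<S>. indep_cols F' S)"
        if "dist F2 F < e" using F2 that r(2)[of F2] by (intro bexI[of _ F2]) auto
      moreover have "dist F2 F < e"
        using F2(2) F1(2) dist_triangle_half_r[of F1 F2 e F] by (simp add: dist_commute)
      ultimately show "\<exists>F'\<in>X. dist F' F < e \<and> (\<forall>S\<in>insert S \<S>. indep_cols F' S)" by blast
    qed
  qed
  let ?U = "{F \<in> X. full_spark F}"
  let ?O = "\<Inter>S\<in>{S. card S = CARD('d)}. {F :: 'a^'n^'d. indep_cols F S}"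
  have "open ?O" by (intro open_INT open_indep_cols ballI) simp
  moreover have "?U = X \<inter> ?O" by (auto simp: full_spark_iff)
  ultimately have op: "openin (top_of_set X) ?U" by (simp add: openin_open_Int)
  have "X \<subseteq> closure ?U"
  proof
    fix F assume "F \<in> X"
    have "\<exists>F'\<in>?U. dist F' F < e" if e: "e > 0" for e
    proof -
      obtain F' where "F' \<in> X" "dist F' F < e" "\<forall>S\<in>{S. card S = CARD('d)}. indep_cols F' S"
        using all[OF order_refl] \<open>F \<in> X\<close> e by blast
      thus ?thesis by (intro bexI[of _ F']) (simp_all add: full_spark_iff)
    qed
    thus "F \<in> closure ?U" unfolding closure_approachable by blast
  qed
  moreover have "X \<inter> ?U = ?U" by blast
  ultimately have "top_of_set X closure_of ?U = X"
    using closure_of_subtopology[of euclidean X ?U] by (simp only: euclidean_closure_of) blast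
  with op show ?thesis unfolding generic_in_def
    by (intro conjI exI[of _ ?U]) (assumption | rule order_refl Collect_restrict)+
qed

section \<open>Rotating two columns\<close>

text \<open>
  For \<open>s' = cnj s\<close> and real \<open>c\<close> with \<open>c\<^sup>2 + |s|\<^sup>2 = 1\<close> this is right multiplication by a unitary matrix.  Keeping
  \<open>s\<close> and \<open>s'\<close> separate lets one algebraic identity serve both fields.
\<close>

definition rotate_cols ::
    "'n::finite \<Rightarrow> 'n \<Rightarrow> 'a \<Rightarrow> 'a \<Rightarrow> 'a \<Rightarrow> 'a::comm_ring_1^'n^'d::finite \<Rightarrow> 'a^'n^'d" where
  "rotate_cols k j c s s' F = (\<chi> a l. if l = k then c * F $ a $ k + s * F $ a $ j
     else if l = j then c * F $ a $ j - s' * F $ a $ k else F $ a $ l)"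

lemma column_rotate_cols:
  "column l (rotate_cols k j c s s' F) =
    (if l = k then c *s column k F + s *s column j F
     else if l = j then c *s column j F - s' *s column k F else column l F)"
  by (simp add: rotate_cols_def column_def vec_eq_iff)

text \<open>
  The invariance of \<open>F F\<^sup>*\<close>, with \<open>G\<close> in the role of the entrywise conjugate of \<open>F\<close>; conjugation
  exchanges \<open>s\<close> and \<open>s'\<close>.
\<close>

lemma rotate_cols_pairing:
  fixes F G :: "'c::comm_ring_1^'b::finite^'d::finite"
  assumes "k \<noteq> j" and cs: "c * c + s * s' = 1"
  shows "(\<Sum>l\<in>UNIV. rotate_cols k j c s s' F $ a $ l * rotate_cols k j c s' s G $ b $ l) =
    (\<Sum>l\<in>UNIV. F $ a $ l * G $ b $ l)"
proof -
  have split: "sum f UNIV = f k + f j + sum f (UNIV - {k} - {j})" for f :: "'b \<Rightarrow> 'c::comm_ring_1"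
    using assms(1) sum.remove[of UNIV k f] sum.remove[of "UNIV - {k}" j f] by (simp add: add.assoc)
  have alg: "(c * x + s * y) * (c * u + s' * v) + (c * y - s' * x) * (c * v - s * u)
      = (c * c + s * s') * (x * u + y * v)" for x y u v
    by (simp add: algebra_simps)
  show ?thesis unfolding split
    using assms alg[of "F $ a $ k" "F $ a $ j" "G $ b $ k" "G $ b $ j"]
    by (simp add: rotate_cols_def)
qed

lemma tendsto_rotate_cols:
  fixes F :: "'a::real_normed_field^'n::finite^'d::finite"
  assumes "(c \<longlongrightarrow> 1) L" "(s \<longlongrightarrow> 0) L" "(s' \<longlongrightarrow> 0) L" "(G \<longlongrightarrow> F) L"
  shows "((\<lambda>t. rotate_cols k j (c t) (s t) (s' t) (G t)) \<longlongrightarrow> F) L"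
proof -
  have G: "((\<lambda>t. G t $ a $ l) \<longlongrightarrow> F $ a $ l) L" for a l
    by (intro tendsto_vec_nth assms)
  have "((\<lambda>t. c t * G t $ a $ k + s t * G t $ a $ j) \<longlongrightarrow> 1 * F $ a $ k + 0 * F $ a $ j) L"
    "((\<lambda>t. c t * G t $ a $ j - s' t * G t $ a $ k) \<longlongrightarrow> 1 * F $ a $ j - 0 * F $ a $ k) L" for a
    by (intro tendsto_intros assms G)+
  hence "((\<lambda>t. rotate_cols k j (c t) (s t) (s' t) (G t) $ a $ l) \<longlongrightarrow> F $ a $ l) L" for a l
    by (cases "l = k"; cases "l = j") (simp_all add: rotate_cols_def G)
  thus ?thesis by (intro vec_tendstoI)
qed

text \<open>
  Since column \<open>j\<close> is outside the span of \<open>T\<close>, a relation among the new columns cannot involve column \<open>k\<close>.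
  It is therefore an old relation, a multiple of \<open>c\<close>, and \<open>c\<^sub>k \<noteq> 0\<close> forces it to vanish.
\<close>

lemma indep_cols_rotate:
  fixes F :: "'a::field^'n::finite^'d::finite"
  assumes sole: "sole_dependence F T c" and ck: "c $ k \<noteq> 0" and s: "s \<noteq> 0"
    and j: "\<And>x. x \<in> coeffs_on T \<Longrightarrow> F *v x \<noteq> column j F"
  shows "indep_cols (rotate_cols k j a s s' F) T"
proof -
  have jT: "j \<notin> T" using j by (rule not_mem_if_column_outside)
  have kT: "k \<in> T" using sole ck by (auto simp: sole_dependence_def coeffs_on_def)
  show ?thesis unfolding indep_cols_def
  proof (intro ballI impI)
    fix x assume x: "x \<in> coeffs_on T" and 0: "rotate_cols k j a s s' F *v x = 0"
    \<comment> \<open>The part of the relation \<open>x\<close> that stays in the old span of \<open>T\<close>.\<close>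
    define y where "y = (\<chi> l. if l = k then a * x $ k else x $ l)"
    have y: "y \<in> coeffs_on T" using x kT by (auto simp: coeffs_on_def y_def)
    have "(\<Sum>l\<in>T. x $ l *s column l (rotate_cols k j a s s' F)) =
       (\<Sum>l\<in>T. y $ l *s column l F + (if l = k then (x $ k * s) *s column j F else 0))"
      using jT by (intro sum.cong refl)
        (auto simp: column_rotate_cols y_def vec_eq_iff algebra_simps)
    also have "\<dots> = F *v y + (x $ k * s) *s column j F"
      using kT by (simp add: sum.distrib mult_coeffs_on[OF y])
    finally have eq: "F *v y + (x $ k * s) *s column j F = 0"
      using 0 mult_coeffs_on[OF x, of "rotate_cols k j a s s' F"] by simp
    have xk: "x $ k = 0"
    proof (rule ccontr)
      assume n: "x $ k \<noteq> 0"
      let ?z = "(- inverse (x $ k * s)) *s y"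
      have "?z \<in> coeffs_on T" using y by (auto simp: coeffs_on_def)
      moreover have "F *v ?z = column j F"
      proof -
        have "F *v y = - ((x $ k * s) *s column j F)" using eq by (simp add: eq_neg_iff_add_eq_0)
        thus ?thesis unfolding vector_scalar_commute using n s
          by (simp add: vec_eq_iff field_simps)
      qed
      ultimately show False using j by blast
    qed
    hence "y = x" by (simp add: y_def vec_eq_iff)
    hence "F *v x = 0" using eq xk by simp
    then obtain m where m: "x = m *s c" using sole x by (auto simp: sole_dependence_def)
    with xk ck have "m = 0" by simp
    with m show "x = 0" by simp
  qed
qed


section \<open>Limits, norms and surjectivity\<close>

lemma exists_near_limit:
  fixes G :: "real \<Rightarrow> 'b::metric_space"
  assumes "(G \<longlongrightarrow> F) (at 0)" "\<forall>\<^sub>F t in at 0. G t \<in> X" "\<forall>\<^sub>F t in at 0. P (G t)" "e > 0"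
  shows "\<exists>F'\<in>X. dist F' F < e \<and> P F'"
proof -
  have "\<forall>\<^sub>F t in at 0. dist (G t) F < e" using assms by (auto dest: tendstoD)
  hence "\<forall>\<^sub>F t in at 0. dist (G t) F < e \<and> G t \<in> X \<and> P (G t)"
    using assms by (auto intro!: eventually_conj)
  thus ?thesis using eventually_happens[of _ "at (0::real)"] by auto
qed

lemma eventually_sin_nonzero: "\<forall>\<^sub>F t in at (0::real). sin t \<noteq> 0"
  unfolding eventually_at
  by (rule exI[of _ pi]) (auto simp: dist_real_def dest: sin_eq_0_pi[rotated 2])

lemma cos_sin_at_0:
  "((\<lambda>t::real. cos t) \<longlongrightarrow> 1) (at 0)" "((\<lambda>t::real. sin t) \<longlongrightarrow> 0) (at 0)"
  using tendsto_cos[OF tendsto_ident_at, of 0 UNIV] tendsto_sin[OF tendsto_ident_at, of 0 UNIV]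
  by simp_all

lemma sinc_at_0: "((\<lambda>t::real. sin t / t) \<longlongrightarrow> 1) (at 0)"
  using DERIV_sin[of "0::real"] by (simp add: DERIV_def)

lemma norm_combination_orthogonal:
  fixes u v :: "'v::real_inner"
  assumes "norm u = 1" "norm v = 1" "u \<bullet> v = 0" "a\<^sup>2 + b\<^sup>2 = (1::real)"
  shows "norm (a *\<^sub>R u + b *\<^sub>R v) = 1"
  using assms by (simp add: norm_eq_1 inner_add_left inner_add_right inner_commute[of v u] power2_eq_square)

lemma surj_if_mult_mat:
  fixes F :: "'a::field^'n::finite^'d::finite"
  assumes "F ** G = mat r" "r \<noteq> 0"
  shows "surj ((*v) F)"
proof (rule surjI)
  fix y
  have "mat r *v x = r *s x" for x :: "'a^'d"
    by (simp add: vec_eq_iff matrix_vector_mult_def mat_def if_distrib[of "\<lambda>x. x * _"] cong: if_cong)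
  thus "F *v (G *v (inverse r *s y)) = y"
    using assms by (simp add: matrix_vector_mul_assoc)
qed

lemma norm_smult_vec: "norm (w *s v) = norm w * norm v"
  for v :: "'a::real_normed_field^'d::finite"
  by (simp add: norm_vec_def norm_mult L2_set_right_distrib)

section \<open>The complex case\<close>

text \<open>
  The inner product here is the real one, \<open>Re \<langle>u, w v\<rangle>\<close>: its vanishing is just what a rotation with
  real angle needs in order to keep norms, and it amounts to \<open>\<langle>u, w v\<rangle>\<close> being purely imaginary.
\<close>

lemma orthogonalising_phase:
  fixes u v :: "complex^'d::finite"
  obtains w where "cmod w = 1" "u \<bullet> (w *s v) = 0"
proof -
  define z where "z = (\<Sum>a\<in>UNIV. u $ a * cnj (v $ a))"
  have eq: "u \<bullet> (w *s v) = Re (cnj w * z)" for w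
    by (simp add: inner_vec_def z_def inner_complex_def sum_distrib_left algebra_simps)
  show thesis
  proof (cases "z = 0")
    case True
    thus thesis using that[of 1] eq[of 1] by simp
  next
    case False
    let ?w = "\<i> * z / cmod z"
    have "cnj ?w * z = - \<i> * (z * cnj z) / cmod z" by simp
    also have "\<dots> = - \<i> * cmod z" using False
      by (simp add: complex_norm_square[symmetric] power2_eq_square)
    finally have "Re (cnj ?w * z) = 0" by simp
    thus thesis using that[of ?w] eq[of ?w] False by (simp add: norm_mult norm_divide)
  qed
qed

lemma perturb_complex:
  fixes F :: "complex^'n::finite^'d::finite"
  assumes F: "F \<in> complex_FUNTF" and sole: "sole_dependence F T c"
    and j: "\<And>x. x \<in> coeffs_on T \<Longrightarrow> F *v x \<noteq> column j F" and e: "e > 0"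
  shows "\<exists>F'\<in>complex_FUNTF. dist F' F < e \<and> indep_cols F' T"
proof -
  obtain k where k: "c $ k \<noteq> 0" using sole by (auto simp: sole_dependence_def vec_eq_iff)
  have "k \<in> T" using sole k by (auto simp: sole_dependence_def coeffs_on_def)
  moreover have "j \<notin> T" using j by (rule not_mem_if_column_outside)
  ultimately have kj: "k \<noteq> j" by auto
  obtain w where w: "cmod w = 1" "column k F \<bullet> (w *s column j F) = 0"
    by (rule orthogonalising_phase)
  have ww: "w * cnj w = 1" using w(1) by (simp add: complex_norm_square[symmetric])
  define G where "G = (\<lambda>t. rotate_cols k j (of_real (cos t)) (of_real (sin t) * w)
      (of_real (sin t) * cnj w) F)"
  have nF: "norm (column l F) = 1" for l using F by (simp add: complex_FUNTF_def)
  have "G t \<in> complex_FUNTF" for t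
  proof -
    have cnj_rot: "cnj (G t $ b $ l) = rotate_cols k j (of_real (cos t)) (of_real (sin t) * cnj w)
      (of_real (sin t) * w) (\<chi> a l. cnj (F $ a $ l)) $ b $ l" for b l
      by (simp add: G_def rotate_cols_def)
    have "of_real (cos t) * of_real (cos t) + of_real (sin t) * w * (of_real (sin t) * cnj w)
      = of_real (cos t * cos t) + of_real (sin t * sin t) * (w * cnj w)"
      by (simp add: algebra_simps)
    also have "\<dots> = of_real (cos t * cos t + sin t * sin t)"
      by (simp only: ww mult_1_right of_real_add)
    also have "cos t * cos t + sin t * sin t = 1" using sin_cos_squared_add2[of t]
      by (simp add: power2_eq_square)
    finally have one: "of_real (cos t) * of_real (cos t) +
        of_real (sin t) * w * (of_real (sin t) * cnj w) = 1" by simp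
    have "(G t ** conj_transpose (G t)) $ a $ b = (F ** conj_transpose F) $ a $ b" for a b
      using rotate_cols_pairing[OF kj one, of F a "\<chi> a l. cnj (F $ a $ l)" b]
      unfolding matrix_matrix_mult_def conj_transpose_def
      by (simp add: cnj_rot) (simp add: G_def)
    hence "G t ** conj_transpose (G t) = F ** conj_transpose F" by (simp add: vec_eq_iff)
    moreover have "norm (column l (G t)) = 1" for l
    proof -
      have wv: "norm (w *s column j F) = 1" by (simp add: norm_smult_vec w nF)
      have "of_real (cos t) *s column k F + (of_real (sin t) * w) *s column j F
          = cos t *\<^sub>R column k F + sin t *\<^sub>R (w *s column j F)"
        by (simp add: vec_eq_iff scaleR_conv_of_real[where 'a=complex] mult.assoc)
      also have "norm \<dots> = 1"
        by (rule norm_combination_orthogonal) (use nF wv w in auto)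
      finally have col_k: "norm (of_real (cos t) *s column k F + (of_real (sin t) * w) *s column j F) = 1" .
      have "of_real (cos t) *s column j F - (of_real (sin t) * cnj w) *s column k F
          = cnj w *s (- sin t *\<^sub>R column k F + cos t *\<^sub>R (w *s column j F))"
        using ww by (simp add: vec_eq_iff scaleR_conv_of_real[where 'a=complex] algebra_simps)
      also have "norm \<dots> = norm (- sin t *\<^sub>R column k F + cos t *\<^sub>R (w *s column j F))"
        unfolding norm_smult_vec using w by simp
      also have "\<dots> = 1"
        by (rule norm_combination_orthogonal) (use nF wv w in auto)
      finally show ?thesis
        unfolding G_def column_rotate_cols using nF col_k by simp
    qed
    ultimately show ?thesis using F by (simp add: complex_FUNTF_def)
  qed
  moreover have "(G \<longlongrightarrow> F) (at 0)"
  proof -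
    have "((\<lambda>t. of_real (cos t) :: complex) \<longlongrightarrow> of_real 1) (at 0)"
      "((\<lambda>t. of_real (sin t) * w) \<longlongrightarrow> of_real 0 * w) (at 0)"
      "((\<lambda>t. of_real (sin t) * cnj w) \<longlongrightarrow> of_real 0 * cnj w) (at 0)"
      by (intro tendsto_intros cos_sin_at_0)+
    thus ?thesis unfolding G_def by (intro tendsto_rotate_cols) simp_all
  qed
  moreover have "\<forall>\<^sub>F t in at 0. indep_cols (G t) T"
    using eventually_sin_nonzero
  proof eventually_elim
    case (elim t)
    thus ?case unfolding G_def using w(1)
      by (intro indep_cols_rotate[OF sole k _ j]) auto
  qed
  ultimately show ?thesis using e by (intro exists_near_limit[where G = G]) auto
qed

section \<open>The real case: rotating three vectors\<close>

lemma pairing_norm_rotation: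
  fixes x y :: "'v::real_inner"
  assumes "c\<^sup>2 + s\<^sup>2 = (1::real)"
  shows "(c *\<^sub>R x + s *\<^sub>R y) \<bullet> (c *\<^sub>R x + s *\<^sub>R y) + (c *\<^sub>R y - s *\<^sub>R x) \<bullet> (c *\<^sub>R y - s *\<^sub>R x)
    = x \<bullet> x + y \<bullet> y"
proof -
  have "(c *\<^sub>R x + s *\<^sub>R y) \<bullet> (c *\<^sub>R x + s *\<^sub>R y) + (c *\<^sub>R y - s *\<^sub>R x) \<bullet> (c *\<^sub>R y - s *\<^sub>R x)
    = (c\<^sup>2 + s\<^sup>2) * (x \<bullet> x + y \<bullet> y)"
    by (simp add: inner_simps inner_commute[of y x] power2_eq_square algebra_simps)
  thus ?thesis using assms by simp
qed

lemma norm_rotation_expand: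
  fixes x y :: "'v::real_inner"
  shows "(c *\<^sub>R x + s *\<^sub>R y) \<bullet> (c *\<^sub>R x + s *\<^sub>R y) = c\<^sup>2 * (x \<bullet> x) + 2 * (c * s) * (x \<bullet> y) + s\<^sup>2 * (y \<bullet> y)"
  by (simp add: inner_simps inner_commute[of y x] power2_eq_square algebra_simps)

text \<open>
  Rotating the pair \<open>(u, v)\<close> by \<open>t\<close> changes the squared norms to \<open>1 + \<delta>\<close> and \<open>1 - \<delta>\<close>.  Rotating \<open>(u, w)\<close> by \<open>\<psi>\<close> then
  restores the norm of \<open>u\<close> and passes the excess \<open>\<delta>\<close> on to \<open>w\<close>, and rotating \<open>(v, w)\<close> by \<open>\<phi>\<close> lets \<open>w\<close> and \<open>v\<close> cancel
  their opposite errors.  The last two steps can be solved for the angle because \<open>\<langle>u, w\<rangle>\<close> and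
  \<open>\<langle>v, w\<rangle>\<close> stay away from 0.  The asymptotics of \<open>\<phi>\<close> decide how much of \<open>v\<close> ends up in \<open>w\<close>, to first order in \<open>t\<close>.
\<close>

lemma triple_rotation_angles:
  fixes u v w :: "'v::real_inner"
  assumes unit: "norm u = 1" "norm v = 1" "norm w = 1"
    and uw: "u \<bullet> w \<noteq> 0" and vw: "v \<bullet> w \<noteq> 0"
  obtains \<psi> \<phi> :: "real \<Rightarrow> real" where
    "(\<psi> \<longlongrightarrow> 0) (at 0)" "((\<lambda>t. sin (\<phi> t) / t) \<longlongrightarrow> (u \<bullet> v) / (v \<bullet> w)) (at 0)" "(\<phi> \<longlongrightarrow> 0) (at 0)"
    "\<forall>\<^sub>F t in at 0. \<forall>u1 v1 u2 w2 v3 w3.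
       u1 = cos t *\<^sub>R u + sin t *\<^sub>R v \<longrightarrow> v1 = cos t *\<^sub>R v - sin t *\<^sub>R u \<longrightarrow>
       u2 = cos (\<psi> t) *\<^sub>R u1 + sin (\<psi> t) *\<^sub>R w \<longrightarrow> w2 = cos (\<psi> t) *\<^sub>R w - sin (\<psi> t) *\<^sub>R u1 \<longrightarrow>
       v3 = cos (\<phi> t) *\<^sub>R v1 + sin (\<phi> t) *\<^sub>R w2 \<longrightarrow> w3 = cos (\<phi> t) *\<^sub>R w2 - sin (\<phi> t) *\<^sub>R v1 \<longrightarrow>
       norm u2 = 1 \<and> norm v3 = 1 \<and> norm w3 = 1"
proof -
  have uu: "u \<bullet> u = 1" "v \<bullet> v = 1" "w \<bullet> w = 1" using unit by (simp_all add: norm_eq_1)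
  define \<delta> where "\<delta> = (\<lambda>t. 2 * (cos t * sin t) * (u \<bullet> v))"
  define u1 where "u1 = (\<lambda>t. cos t *\<^sub>R u + sin t *\<^sub>R v)"
  define v1 where "v1 = (\<lambda>t. cos t *\<^sub>R v - sin t *\<^sub>R u)"
  define m where "m = (\<lambda>t. u1 t \<bullet> w)"
  define \<psi> where "\<psi> = (\<lambda>t. arctan (- \<delta> t / (2 * m t)))"
  define u2 where "u2 = (\<lambda>t. cos (\<psi> t) *\<^sub>R u1 t + sin (\<psi> t) *\<^sub>R w)"
  define w2 where "w2 = (\<lambda>t. cos (\<psi> t) *\<^sub>R w - sin (\<psi> t) *\<^sub>R u1 t)"
  define q where "q = (\<lambda>t. v1 t \<bullet> w2 t)"
  define X where "X = (\<lambda>t. \<delta> t / q t)"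
  define \<phi> where "\<phi> = (\<lambda>t. arctan (X t) / 2)"
  define v3 where "v3 = (\<lambda>t. cos (\<phi> t) *\<^sub>R v1 t + sin (\<phi> t) *\<^sub>R w2 t)"
  define w3 where "w3 = (\<lambda>t. cos (\<phi> t) *\<^sub>R w2 t - sin (\<phi> t) *\<^sub>R v1 t)"
  have u1_lim: "(u1 \<longlongrightarrow> 1 *\<^sub>R u + 0 *\<^sub>R v) (at 0)" unfolding u1_def
    by (intro tendsto_intros cos_sin_at_0)
  have v1_lim: "(v1 \<longlongrightarrow> 1 *\<^sub>R v - 0 *\<^sub>R u) (at 0)" unfolding v1_def
    by (intro tendsto_intros cos_sin_at_0)
  have m_lim: "(m \<longlongrightarrow> u \<bullet> w) (at 0)"
    using tendsto_inner[OF u1_lim tendsto_const[of w]] by (simp add: m_def)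
  have d_lim: "(\<delta> \<longlongrightarrow> 2 * (1 * 0) * (u \<bullet> v)) (at 0)" unfolding \<delta>_def
    by (intro tendsto_intros cos_sin_at_0)
  have "(\<psi> \<longlongrightarrow> arctan (- (2 * (1 * 0) * (u \<bullet> v)) / (2 * (u \<bullet> w)))) (at 0)" unfolding \<psi>_def
    by (intro tendsto_intros m_lim d_lim) (use uw in auto)
  hence psi_lim: "(\<psi> \<longlongrightarrow> 0) (at 0)" by simp
  have "(w2 \<longlongrightarrow> cos 0 *\<^sub>R w - sin 0 *\<^sub>R (1 *\<^sub>R u + 0 *\<^sub>R v)) (at 0)" unfolding w2_def
    by (intro tendsto_intros psi_lim u1_lim)
  hence w2_lim: "(w2 \<longlongrightarrow> w) (at 0)" by simp
  have q_lim: "(q \<longlongrightarrow> v \<bullet> w) (at 0)"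
    using tendsto_inner[OF v1_lim w2_lim] by (simp add: q_def)
  have "((\<lambda>t. 2 * (cos t * (sin t / t)) * (u \<bullet> v) / q t) \<longlongrightarrow> 2 * (1 * 1) * (u \<bullet> v) / (v \<bullet> w)) (at 0)"
    by (intro tendsto_intros cos_sin_at_0 sinc_at_0 q_lim) (use vw in auto)
  hence "((\<lambda>t. X t / t) \<longlongrightarrow> 2 * (u \<bullet> v) / (v \<bullet> w)) (at 0)"
    by (simp add: X_def \<delta>_def field_simps)
  moreover have X0: "X 0 = 0" by (simp add: X_def \<delta>_def)
  ultimately have "(X has_real_derivative 2 * (u \<bullet> v) / (v \<bullet> w)) (at 0)" by (simp add: DERIV_def)
  hence phi_deriv: "(\<phi> has_real_derivative (u \<bullet> v) / (v \<bullet> w)) (at 0)" unfolding \<phi>_def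
    by (auto intro!: derivative_eq_intros simp: X0)
  have phi0: "\<phi> 0 = 0" by (simp add: \<phi>_def X0)
  have phi_lim: "(\<phi> \<longlongrightarrow> 0) (at 0)"
    using DERIV_isCont[OF phi_deriv] by (simp add: isCont_def phi0)
  have slope: "((\<lambda>t. sin (\<phi> t) / t) \<longlongrightarrow> (u \<bullet> v) / (v \<bullet> w)) (at 0)"
    using DERIV_chain2[OF DERIV_sin phi_deriv] by (simp add: DERIV_def phi0)
  have "\<forall>\<^sub>F t in at 0. m t \<noteq> 0 \<and> q t \<noteq> 0"
    using tendsto_imp_eventually_ne[OF m_lim uw] tendsto_imp_eventually_ne[OF q_lim vw]
    by eventually_elim simp
  hence "\<forall>\<^sub>F t in at 0. norm (u2 t) = 1 \<and> norm (v3 t) = 1 \<and> norm (w3 t) = 1"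
  proof eventually_elim
    case (elim t)
    have u1u1: "u1 t \<bullet> u1 t = 1 + \<delta> t"
      unfolding u1_def norm_rotation_expand \<delta>_def by (simp add: uu)
    have v1v1: "v1 t \<bullet> v1 t = 1 - \<delta> t"
      using pairing_norm_rotation[of "cos t" "sin t" u v] u1u1 by (simp add: uu u1_def v1_def)
    have "sin (\<psi> t) = tan (\<psi> t) * cos (\<psi> t)" by (simp add: tan_def \<psi>_def)
    \<comment> \<open>The equation that \<open>\<psi>\<close> solves: the excess of \<open>u2\<close> vanishes.\<close>
    hence s: "2 * sin (\<psi> t) * m t = - \<delta> t * cos (\<psi> t)" using elim by (simp add: \<psi>_def tan_arctan)
    have "u2 t \<bullet> u2 t = ((sin (\<psi> t))\<^sup>2 + (cos (\<psi> t))\<^sup>2)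
        + cos (\<psi> t) * (2 * sin (\<psi> t) * m t + \<delta> t * cos (\<psi> t))"
      unfolding u2_def norm_rotation_expand u1u1 m_def[symmetric]
      by (simp add: uu m_def algebra_simps power2_eq_square)
    hence u2u2: "u2 t \<bullet> u2 t = 1" by (simp add: s)
    have w2w2: "w2 t \<bullet> w2 t = 1 + \<delta> t"
      using pairing_norm_rotation[of "cos (\<psi> t)" "sin (\<psi> t)" "u1 t" w] u1u1 u2u2
      by (simp add: uu u2_def w2_def)
    have "sin (2 * \<phi> t) = tan (2 * \<phi> t) * cos (2 * \<phi> t)" by (simp add: tan_def \<phi>_def)
    \<comment> \<open>Likewise for \<open>\<phi>\<close> and \<open>v3\<close>; the norm of \<open>w3\<close> follows because the sum of squares is kept.\<close>
    hence s: "sin (2 * \<phi> t) * q t = \<delta> t * cos (2 * \<phi> t)"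
      using elim by (simp add: \<phi>_def tan_arctan X_def)
    have "v3 t \<bullet> v3 t = ((sin (\<phi> t))\<^sup>2 + (cos (\<phi> t))\<^sup>2)
       + (sin (2 * \<phi> t) * q t - \<delta> t * cos (2 * \<phi> t))"
      unfolding v3_def norm_rotation_expand v1v1 w2w2 sin_double cos_double
      by (simp add: q_def algebra_simps)
    hence v3v3: "v3 t \<bullet> v3 t = 1" by (simp add: s)
    have "w3 t \<bullet> w3 t = 1"
      using pairing_norm_rotation[of "cos (\<phi> t)" "sin (\<phi> t)" "v1 t" "w2 t"] v1v1 w2w2 v3v3
      by (simp add: v3_def w3_def)
    thus ?case using u2u2 v3v3 by (simp add: norm_eq_1)
  qed
  hence "\<forall>\<^sub>F t in at 0. \<forall>u1 v1 u2 w2 v3 w3.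
       u1 = cos t *\<^sub>R u + sin t *\<^sub>R v \<longrightarrow> v1 = cos t *\<^sub>R v - sin t *\<^sub>R u \<longrightarrow>
       u2 = cos (\<psi> t) *\<^sub>R u1 + sin (\<psi> t) *\<^sub>R w \<longrightarrow> w2 = cos (\<psi> t) *\<^sub>R w - sin (\<psi> t) *\<^sub>R u1 \<longrightarrow>
       v3 = cos (\<phi> t) *\<^sub>R v1 + sin (\<phi> t) *\<^sub>R w2 \<longrightarrow> w3 = cos (\<phi> t) *\<^sub>R w2 - sin (\<phi> t) *\<^sub>R v1 \<longrightarrow>
       norm u2 = 1 \<and> norm v3 = 1 \<and> norm w3 = 1"
    by (simp add: u1_def u2_def v1_def w2_def v3_def w3_def)
  with that psi_lim slope phi_lim show thesis by blast
qed

section \<open>The real case: breaking the relation to first order\<close>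

text \<open>
  If relations persisted for arbitrarily small \<open>t\<close>, normalised ones would converge to a multiple of \<open>c\<close>, the
  only relation at \<open>t = 0\<close>.  Applying \<open>p\<close> to them and dividing by \<open>t\<close> would then yield \<open>\<Sum> c\<^sub>s h\<^sub>s = 0\<close> in the limit.
\<close>

lemma indep_cols_first_order:
  fixes G :: "real \<Rightarrow> real^'n::finite^'d::finite"
  assumes lim: "(G \<longlongrightarrow> F) (at 0)" and sole: "sole_dependence F T c"
    and slope: "\<And>s. s \<in> T \<Longrightarrow> ((\<lambda>t. (p \<bullet> column s (G t)) / t) \<longlongrightarrow> h s) (at 0)"
    and nz: "(\<Sum>s\<in>T. c $ s * h s) \<noteq> 0"
  shows "\<forall>\<^sub>F t in at 0. indep_cols (G t) T"
proof (rule ccontr)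
  assume "\<not> ?thesis"
  hence "\<exists>t. t \<noteq> 0 \<and> \<bar>t\<bar> < inverse (real (Suc n)) \<and> \<not> indep_cols (G t) T" for n
    unfolding eventually_at by (auto simp: dist_real_def simp del: of_nat_Suc)
  then obtain \<tau> where \<tau>: "\<And>n. \<tau> n \<noteq> 0" "\<And>n. \<bar>\<tau> n\<bar> < inverse (real (Suc n))"
    "\<And>n. \<not> indep_cols (G (\<tau> n)) T" by metis
  have "(\<lambda>n. \<bar>\<tau> n\<bar>) \<longlonglongrightarrow> 0"
  proof (rule tendsto_sandwich[OF _ _ tendsto_const LIMSEQ_inverse_real_of_nat])
    show "\<forall>\<^sub>F n in sequentially. \<bar>\<tau> n\<bar> \<le> inverse (real (Suc n))"
      by (intro always_eventually allI less_imp_le \<tau>(2))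
  qed simp
  hence "\<tau> \<longlonglongrightarrow> 0" by (rule tendsto_rabs_zero_cancel)
  hence at: "filterlim \<tau> (at 0) sequentially" by (simp add: filterlim_at \<tau>(1))
  obtain r x x0 where x: "strict_mono (r :: nat \<Rightarrow> nat)" "\<And>n. x n \<in> coeffs_on T"
    "\<And>n. G (\<tau> (r n)) *v x n = 0" "x \<longlonglongrightarrow> x0" "x0 \<in> coeffs_on T" "x0 \<noteq> 0" "F *v x0 = 0"
    using dependence_limit[OF filterlim_compose[OF lim at] \<tau>(3)] by metis
  obtain \<mu> where \<mu>: "x0 = \<mu> *s c" using sole x by (auto simp: sole_dependence_def)
  have at': "filterlim (\<lambda>n. \<tau> (r n)) (at 0) sequentially"
    using filterlim_compose[OF at filterlim_subseq[OF x(1)]] .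
  have "(\<lambda>n. \<Sum>s\<in>T. x n $ s * ((p \<bullet> column s (G (\<tau> (r n)))) / \<tau> (r n))) \<longlonglongrightarrow>
      (\<Sum>s\<in>T. x0 $ s * h s)"
    by (intro tendsto_intros tendsto_vec_nth[OF x(4)] filterlim_compose[OF slope at'])
  moreover have "(\<Sum>s\<in>T. x n $ s * ((p \<bullet> column s (G (\<tau> (r n)))) / \<tau> (r n))) = 0" for n
  proof -
    have "(\<Sum>s\<in>T. x n $ s * ((p \<bullet> column s (G (\<tau> (r n)))) / \<tau> (r n)))
      = (p \<bullet> (G (\<tau> (r n)) *v x n)) / \<tau> (r n)"
      unfolding mult_coeffs_on[OF x(2)]
      by (simp add: inner_sum_right sum_divide_distrib scalar_mult_eq_scaleR)
    thus ?thesis by (simp add: x(3))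
  qed
  ultimately have "(\<Sum>s\<in>T. x0 $ s * h s) = 0" by (simp add: LIMSEQ_const_iff)
  hence "\<mu> * (\<Sum>s\<in>T. c $ s * h s) = 0" by (simp add: \<mu> sum_distrib_left mult.assoc)
  with nz have "\<mu> = 0" by simp
  with \<mu> x(6) show False by simp
qed

text \<open>
  Let \<open>g\<^sub>k = \<langle>v, f\<^sub>k\<rangle>\<close> on the support of \<open>c\<close>.  If \<open>g\<close> and \<open>c\<close> were proportional on every non-orthogonal pair,
  then \<open>c\<^sub>l g\<^sub>k \<langle>f\<^sub>l, f\<^sub>k\<rangle> = g\<^sub>l c\<^sub>k \<langle>f\<^sub>l, f\<^sub>k\<rangle>\<close> for all pairs.  Summing over \<open>k\<close> turns the relation \<open>\<Sum> c\<^sub>k f\<^sub>k = 0\<close> into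
  orthogonality of \<open>\<Sum> g\<^sub>k f\<^sub>k\<close> to each \<open>f\<^sub>l\<close> in the support, hence to itself.  So \<open>\<Sum> g\<^sub>k f\<^sub>k = 0\<close>, and pairing it with \<open>v\<close>
  gives \<open>\<Sum> g\<^sub>k\<^sup>2 = 0\<close>.
\<close>

lemma nonproportional_pair:
  fixes F :: "real^'n::finite^'d::finite"
  assumes c: "F *v c = 0" "c \<noteq> 0" and v: "\<And>k. c $ k \<noteq> 0 \<Longrightarrow> v \<bullet> column k F \<noteq> 0"
  obtains i k where "c $ i \<noteq> 0" "c $ k \<noteq> 0" "column i F \<bullet> column k F \<noteq> 0"
    "c $ k * (v \<bullet> column i F) \<noteq> c $ i * (v \<bullet> column k F)"
proof (rule ccontr)
  note pair = that
  assume "\<not> thesis"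
  have ratio: "c $ k * (v \<bullet> column i F) = c $ i * (v \<bullet> column k F)"
    if "c $ i \<noteq> 0" "c $ k \<noteq> 0" "column i F \<bullet> column k F \<noteq> 0" for i k
    using that \<open>\<not> thesis\<close> pair by blast
  define g where "g = (\<chi> k. if c $ k = 0 then 0 else v \<bullet> column k F)"
  have F: "y \<bullet> (F *v x) = (\<Sum>k\<in>UNIV. x $ k * (y \<bullet> column k F))" for x y
    by (simp add: matrix_mult_sum inner_sum_right scalar_mult_eq_scaleR)
  have orth: "column l F \<bullet> (F *v g) = 0" if l: "c $ l \<noteq> 0" for l
  proof -
    have "c $ l * (g $ k * (column l F \<bullet> column k F)) = g $ l * (c $ k * (column l F \<bullet> column k F))" for k
      using ratio[of l k] l by (cases "column l F \<bullet> column k F = 0"; cases "c $ k = 0") (auto simp: g_def mult.commute)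
    hence "c $ l * (column l F \<bullet> (F *v g)) = g $ l * (column l F \<bullet> (F *v c))"
      by (simp only: F sum_distrib_left)
    thus ?thesis using l by (simp add: c)
  qed
  have "(F *v g) \<bullet> (F *v g) = (\<Sum>k\<in>UNIV. g $ k * ((F *v g) \<bullet> column k F))" by (rule F)
  also have "\<dots> = 0"
    by (intro sum.neutral ballI) (use orth in \<open>auto simp: g_def inner_commute\<close>)
  finally have "F *v g = 0" by simp
  hence "0 = v \<bullet> (F *v g)" by simp
  also have "\<dots> = (\<Sum>k\<in>UNIV. (g $ k)\<^sup>2)"
    unfolding F by (intro sum.cong refl) (simp add: g_def power2_eq_square)
  finally have gz: "g $ k = 0" for k by (simp add: sum_nonneg_eq_0_iff)
  have "c $ k = 0" for k using gz[of k] v[of k] by (cases "c $ k = 0") (simp_all add: g_def)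
  with c(2) show False by (simp add: vec_eq_iff)
qed

lemma separating_functional:
  fixes F :: "real^'n::finite^'d::finite"
  assumes "\<And>x. x \<in> coeffs_on T \<Longrightarrow> F *v x \<noteq> v"
  obtains p where "\<And>s. s \<in> T \<Longrightarrow> p \<bullet> column s F = 0" "p \<bullet> v = 1"
proof -
  let ?V = "(*v) F ` coeffs_on T"
  have "subspace (coeffs_on T :: (real^'n) set)" by (auto simp: subspace_def coeffs_on_def)
  hence V: "subspace ?V" by (intro linear_subspace_image) simp_all
  obtain y z where yz: "y \<in> span ?V" "\<And>w. w \<in> span ?V \<Longrightarrow> orthogonal z w" "v = y + z"
    using orthogonal_subspace_decomp_exists[of ?V v] by blast
  have sp: "span ?V = ?V" using V by (simp add: span_eq_iff)
  have "z \<noteq> 0"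
  proof
    assume "z = 0"
    hence "v \<in> ?V" using yz(1,3) sp by simp
    thus False using assms by blast
  qed
  have "z \<bullet> y = 0" using yz by (auto simp: orthogonal_def)
  hence zv: "z \<bullet> v = z \<bullet> z" by (simp add: yz(3) inner_add_right)
  have "z \<bullet> column s F = 0" if "s \<in> T" for s
  proof -
    have "axis s 1 \<in> coeffs_on T" using that by (rule axis_coeffs_on)
    hence "column s F \<in> ?V" by (metis image_eqI mult_axis)
    thus ?thesis using yz(2) sp by (auto simp: orthogonal_def)
  qed
  thus thesis using that[of "z /\<^sub>R (z \<bullet> z)"] zv \<open>z \<noteq> 0\<close> by simp
qed

lemma rotate_cols_tight:
  fixes F :: "real^'n::finite^'d::finite"
  assumes "k \<noteq> j"
  shows "rotate_cols k j (cos t) (sin t) (sin t) F ** transpose (rotate_cols k j (cos t) (sin t) (sin t) F)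
    = F ** transpose F"
proof -
  have "cos t * cos t + sin t * sin t = 1" 
    using sin_cos_squared_add2[of t] by (simp add: power2_eq_square)
  from rotate_cols_pairing[OF assms this, of F _ F] show ?thesis
    by (simp add: vec_eq_iff matrix_matrix_mult_def transpose_def)
qed

text \<open>
  If some \<open>f\<^sub>k\<close> with \<open>c\<^sub>k \<noteq> 0\<close> is orthogonal to \<open>f\<^sub>j\<close>, rotating this pair keeps norms and suffices; otherwise
  the three-vector motion applies to a pair \<open>i\<close>, \<open>k\<close> as in \<open>nonproportional_pair\<close>.
\<close>

lemma perturb_real:
  fixes F :: "real^'n::finite^'d::finite"
  assumes F: "F \<in> real_FUNTF" and sole: "sole_dependence F T c"
    and j: "\<And>x. x \<in> coeffs_on T \<Longrightarrow> F *v x \<noteq> column j F" and e: "e > 0"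
  shows "\<exists>F'\<in>real_FUNTF. dist F' F < e \<and> indep_cols F' T"
proof -
  have jT: "j \<notin> T" using j by (rule not_mem_if_column_outside)
  have inT: "k \<in> T" if "c $ k \<noteq> 0" for k
    using sole that by (auto simp: sole_dependence_def coeffs_on_def)
  have nF: "norm (column l F) = 1" for l using F by (simp add: real_FUNTF_def)
  have lim: "((\<lambda>t. rotate_cols a b (cos (\<theta> t)) (sin (\<theta> t)) (sin (\<theta> t)) (H t)) \<longlongrightarrow> F) (at 0)"
    if "(\<theta> \<longlongrightarrow> 0) (at 0)" "(H \<longlongrightarrow> F) (at 0)" for a b H and \<theta> :: "real \<Rightarrow> real"
    using tendsto_cos[OF that(1)] tendsto_sin[OF that(1)] that(2)
    by (intro tendsto_rotate_cols) simp_all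
  show ?thesis
  proof (cases "\<exists>k. c $ k \<noteq> 0 \<and> column j F \<bullet> column k F = 0")
    case True
    then obtain k where k: "c $ k \<noteq> 0" "column j F \<bullet> column k F = 0" by blast
    have kj: "k \<noteq> j" using inT[OF k(1)] jT by auto
    define G where "G = (\<lambda>t. rotate_cols k j (cos t) (sin t) (sin t) F)"
    have "G t \<in> real_FUNTF" for t
    proof -
      have "norm (column l (G t)) = 1" for l
        using norm_combination_orthogonal[OF nF nF, of k j "cos t" "sin t"]
          norm_combination_orthogonal[OF nF nF, of j k "cos t" "- sin t"] k(2) nF
        unfolding G_def column_rotate_cols by (simp add: scalar_mult_eq_scaleR inner_commute)
      moreover have "G t ** transpose (G t) = F ** transpose F"
        unfolding G_def by (rule rotate_cols_tight[OF kj])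
      ultimately show ?thesis using F by (simp add: real_FUNTF_def)
    qed
    moreover have "(G \<longlongrightarrow> F) (at 0)" unfolding G_def
      by (rule lim[OF tendsto_ident_at tendsto_const])
    moreover have "\<forall>\<^sub>F t in at 0. indep_cols (G t) T"
      using eventually_sin_nonzero
      by eventually_elim (auto simp: G_def intro!: indep_cols_rotate[OF sole k(1) _ j])
    ultimately show ?thesis using e by (intro exists_near_limit[where G = G]) auto
  next
    case False
    obtain i k where ik: "c $ i \<noteq> 0" "c $ k \<noteq> 0" "column i F \<bullet> column k F \<noteq> 0"
      "c $ k * (column j F \<bullet> column i F) \<noteq> c $ i * (column j F \<bullet> column k F)"
      using nonproportional_pair[of F c "column j F"] sole False
      by (metis sole_dependence_def)
    \<comment> \<open>In this case \<open>f\<^sub>i\<close>, \<open>f\<^sub>j\<close>, \<open>f\<^sub>k\<close> are pairwise non-orthogonal, with \<open>f\<^sub>j\<close> outside the span of \<open>T\<close>.\<close>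
    define u v w where "u = column i F" "v = column j F" "w = column k F"
    have ne: "i \<noteq> k" "i \<noteq> j" "k \<noteq> j" using ik inT jT by auto
    have vw: "v \<bullet> w \<noteq> 0" using False ik(2) by (auto simp: u_v_w_def)
    have uvw_unit: "norm u = 1" "norm v = 1" "norm w = 1" and uw: "u \<bullet> w \<noteq> 0"
      using nF ik(3) by (simp_all add: u_v_w_def)
    obtain \<psi> \<phi> :: "real \<Rightarrow> real" where angles:
      "(\<psi> \<longlongrightarrow> 0) (at 0)" "((\<lambda>t. sin (\<phi> t) / t) \<longlongrightarrow> (u \<bullet> v) / (v \<bullet> w)) (at 0)" "(\<phi> \<longlongrightarrow> 0) (at 0)"
      and unit: "\<forall>\<^sub>F t in at 0. \<forall>u1 v1 u2 w2 v3 w3.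
       u1 = cos t *\<^sub>R u + sin t *\<^sub>R v \<longrightarrow> v1 = cos t *\<^sub>R v - sin t *\<^sub>R u \<longrightarrow>
       u2 = cos (\<psi> t) *\<^sub>R u1 + sin (\<psi> t) *\<^sub>R w \<longrightarrow> w2 = cos (\<psi> t) *\<^sub>R w - sin (\<psi> t) *\<^sub>R u1 \<longrightarrow>
       v3 = cos (\<phi> t) *\<^sub>R v1 + sin (\<phi> t) *\<^sub>R w2 \<longrightarrow> w3 = cos (\<phi> t) *\<^sub>R w2 - sin (\<phi> t) *\<^sub>R v1 \<longrightarrow>
       norm u2 = 1 \<and> norm v3 = 1 \<and> norm w3 = 1"
      by (rule triple_rotation_angles[OF uvw_unit uw vw])
    define G where "G = (\<lambda>t. rotate_cols j k (cos (\<phi> t)) (sin (\<phi> t)) (sin (\<phi> t))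
      (rotate_cols i k (cos (\<psi> t)) (sin (\<psi> t)) (sin (\<psi> t))
        (rotate_cols i j (cos t) (sin t) (sin t) F)))"
    define u1 where "u1 = (\<lambda>t. cos t *\<^sub>R u + sin t *\<^sub>R v)"
    define v1 where "v1 = (\<lambda>t. cos t *\<^sub>R v - sin t *\<^sub>R u)"
    define w2 where "w2 = (\<lambda>t. cos (\<psi> t) *\<^sub>R w - sin (\<psi> t) *\<^sub>R u1 t)"
    have colG: "column l (G t) = (if l = i then cos (\<psi> t) *\<^sub>R u1 t + sin (\<psi> t) *\<^sub>R w
        else if l = j then cos (\<phi> t) *\<^sub>R v1 t + sin (\<phi> t) *\<^sub>R w2 t
        else if l = k then cos (\<phi> t) *\<^sub>R w2 t - sin (\<phi> t) *\<^sub>R v1 t else column l F)" for l t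
      using ne by (auto simp: G_def column_rotate_cols u1_def v1_def w2_def u_v_w_def scalar_mult_eq_scaleR)
    have "\<forall>\<^sub>F t in at 0. G t \<in> real_FUNTF" using unit
    proof eventually_elim
      case (elim t)
      have "G t ** transpose (G t) = F ** transpose F"
        unfolding G_def using ne by (simp only: rotate_cols_tight not_sym not_False_eq_True)
      moreover have "norm (column l (G t)) = 1" for l
        using elim nF by (simp add: colG u1_def v1_def w2_def)
      ultimately show ?case using F by (simp add: real_FUNTF_def)
    qed
    moreover have G_lim: "(G \<longlongrightarrow> F) (at 0)" unfolding G_def
      by (intro lim angles tendsto_ident_at tendsto_const)
    moreover have "\<forall>\<^sub>F t in at 0. indep_cols (G t) T"
    proof -
      obtain p where p: "\<And>s. s \<in> T \<Longrightarrow> p \<bullet> column s F = 0" "p \<bullet> v = 1"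
        using separating_functional[OF j] unfolding u_v_w_def by blast
      have pu: "p \<bullet> u = 0" "p \<bullet> w = 0" using p(1) inT ik unfolding u_v_w_def by blast+
      \<comment> \<open>\<open>h s\<close> is the first-order amount of \<open>f\<^sub>j\<close> that the motion mixes into column \<open>s\<close>.\<close>
      define h where "h = (\<lambda>s. if s = i then 1 else if s = k then - ((u \<bullet> v) / (v \<bullet> w)) else 0)"
      have "((\<lambda>t. (p \<bullet> column s (G t)) / t) \<longlongrightarrow> h s) (at 0)" if s: "s \<in> T" for s
      proof -
        consider "s = i" | "s = k" | "s \<noteq> i" "s \<noteq> k" "s \<noteq> j" using s jT by blast
        thus ?thesis
        proof cases
          case 1
          have "((\<lambda>t. cos (\<psi> t) * (sin t / t)) \<longlongrightarrow> cos 0 * 1) (at 0)"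
            by (intro tendsto_intros angles sinc_at_0)
          thus ?thesis using 1 by (simp add: colG h_def u1_def inner_simps p pu)
        next
          case 2
          have "((\<lambda>t. - (cos (\<phi> t) * sin (\<psi> t) * (sin t / t)) - cos t * (sin (\<phi> t) / t)) \<longlongrightarrow>
             - (cos 0 * sin 0 * 1) - 1 * ((u \<bullet> v) / (v \<bullet> w))) (at 0)"
            by (intro tendsto_intros angles sinc_at_0 cos_sin_at_0)
          moreover have "(p \<bullet> column s (G t)) / t =
             - (cos (\<phi> t) * sin (\<psi> t) * (sin t / t)) - cos t * (sin (\<phi> t) / t)" for t
            using 2 ne by (simp add: colG u1_def v1_def w2_def inner_simps p pu diff_divide_distrib mult_ac)
          ultimately show ?thesis using 2 ne by (simp add: h_def)
        next
          case 3
          thus ?thesis using p(1)[OF s] by (simp add: colG h_def)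
        qed
      qed
      moreover have "(\<Sum>s\<in>T. c $ s * h s) \<noteq> 0"
      proof -
        have "(\<Sum>s\<in>T. c $ s * h s) = (\<Sum>s\<in>{i,k}. c $ s * h s)"
          using inT ik by (intro sum.mono_neutral_right) (auto simp: h_def)
        also have "\<dots> = c $ i - c $ k * ((u \<bullet> v) / (v \<bullet> w))" using ne by (simp add: h_def)
        also have "\<dots> \<noteq> 0" using ik(4) vw by (simp add: u_v_w_def inner_commute field_simps)
        finally show ?thesis .
      qed
      ultimately show ?thesis by (rule indep_cols_first_order[OF G_lim sole])
    qed
    ultimately show ?thesis using e by (intro exists_near_limit[where G = G]) auto
  qed
qed

section \<open>Generic frames are full spark\<close>

theorem theorem1p6:
  assumes "CARD('d::finite) \<le> CARD('n::finite)"
  shows "generic_in {F \<in> complex_FUNTF. full_spark F} (complex_FUNTF :: (complex^'n^'d) set) \<and>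
         generic_in {F \<in> real_FUNTF. full_spark F} (real_FUNTF :: (real^'n^'d) set)"
proof
  show "generic_in {F \<in> complex_FUNTF. full_spark F} (complex_FUNTF :: (complex^'n^'d) set)"
  proof (rule generic_full_spark_if_perturbable)
    show "surj ((*v) F)" if "F \<in> complex_FUNTF" for F :: "complex^'n^'d"
      using that by (intro surj_if_mult_mat) (auto simp: complex_FUNTF_def)
  qed (rule perturb_complex)
  show "generic_in {F \<in> real_FUNTF. full_spark F} (real_FUNTF :: (real^'n^'d) set)"
  proof (rule generic_full_spark_if_perturbable)
    show "surj ((*v) F)" if "F \<in> real_FUNTF" for F :: "real^'n^'d"
      using that by (intro surj_if_mult_mat) (auto simp: real_FUNTF_def)
  qed (rule perturb_real)
qed

end
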